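(* Let $(A=(A,\mu),M=(M,l,r),(T_1,T_2))$ be a compatible $\mathcal{O}$-operator algebra. For any formal deformation $(\mu_t,l_t,r_t,T_{1,t},T_{2,t})$ of it, the infinitesimal $(\mu_1+l_1+r_1,(T_{1,1},T_{2,1}))\in C^2_{\mathrm{cOA}}(A,M,(T_1,T_2))$ is a $2$-cocycle in the cochain complex $\{C^\bullet_{\mathrm{cOA}}(A,M,(T_1,T_2)),\delta_{\mathrm{cOA}}\}$. Moreover, the corresponding cohomology class depends only on the equivalence class of the formal deformation (equivalent deformations have cohomologous infinitesimals).
   Context: All vector spaces are over a field $\mathbf{k}$ of characteristic $0$. Compatible $\mathcal{O}$-operator algebras. $(A,M,(T_1,T_2))$ is a compatible $\mathcal{O}$-operator algebra if $(A,\mu)$ is an associative algebra, $(M,l,r)$ (with $l:A\otimes M\to M$, $r:M\otimes A\to M$) is an $A$-bimodule (write $\cdot$ for $\mu,l,r$), and $T_1,T_2:M\to A$ are linear with $T_i(u)\cdot T_i(v)=T_i(T_i(u)\cdot v+u\cdot T_i(v))$ for $i=1,2$ and $$T_1(u)\cdot T_2(v)+T_2(u)\cdot T_1(v)=T_1(T_2(u)\cdot v+u\cdot T_2(v))+T_2(T_1(u)\cdot v+u\cdot T_1(v)),\quad u,v\in M.$$ A morphism from $(A,M,(T_1,T_2))$ to $(A',M',(T_1',T_2'))$ is a pair $(\phi,\psi)$ of an algebra morphism $\phi:A\to A'$ and a linear map $\psi:M\to M'$ with $\psi(a\cdot u)=\phi(a)\cdot\psi(u)$, $\psi(u\cdot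 a)=\psi(u)\cdot\phi(a)$, $\phi\circ T_i=T'_i\circ\psi$ ($i=1,2$). The same definitions are used over $\mathbf{k}[[t]]$. Deformations. A formal deformation consists of $\mu_t=\sum_{i\geq 0} t^i\mu_i$, $l_t=\sum_{i\geq 0} t^il_i$, $r_t=\sum_{i\geq 0} t^ir_i$, $T_{1,t}=\sum_{i\geq 0} t^iT_{1,i}$, $T_{2,t}=\sum_{i\geq 0} t^iT_{2,i}$ with $\mu_i\in\mathrm{Hom}(A^{\otimes2},A)$, $l_i\in\mathrm{Hom}(A\otimes M,M)$, $r_i\in\mathrm{Hom}(M\otimes A,M)$, $T_{1,i},T_{2,i}\in\mathrm{Hom}(M,A)$, zeroth terms $\mu,l,r,T_1,T_2$, such that $((A[[t]],\mu_t),(M[[t]],l_t,r_t),(T_{1,t},T_{2,t}))$ is a compatible $\mathcal{O}$-operator algebra over $\mathbf{k}[[t]]$. Two deformations $(\mu_t,l_t,r_t,T_{1,t},T_{2,t})$ and $(\mu'_t,l'_t,r'_t,T'_{1,t},T'_{2,t})$ are equivalent if there are $\phi_t=\sum_{i\geq 0} t^i\phi_i$, $\psi_t=\sum_{i\geq 0} t^i\psi_i$ with $\phi_i\in\mathrm{Hom}(A,A)$, $\psi_i\in\mathrm{Hom}(M,M)$, $\phi_0=\mathrm{id}_A$, $\psi_0=\mathrm{id}_M$, such that $(\phi_t,\psi_t)$ is a morphism from the first to the second. The spaces. Let $V=\bigoplus_{n\ge0}V_n$, $V_n=\mathrm{Hom}((A\oplus M)^{\otimes n+1},A\oplus M)$,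 with the Gerstenhaber bracket, for $f\in V_m$, $g\in V_n$, $$[f,g]_{\mathsf G}=\sum_{i=1}^{m+1}(-1)^{(i-1)n}f\circ_ig-(-1)^{mn}\sum_{i=1}^{n+1}(-1)^{(i-1)m}g\circ_if,$$ $(f\circ_ig)(v_1,\ldots,v_{m+n+1})=f(v_1,\ldots,v_{i-1},g(v_i,\ldots,v_{i+n}),\ldots,v_{m+n+1})$. Let $\mathcal{A}^{p,q}$ be the sum of all tensor products of $p$ copies of $A$ and $q$ copies of $M$ (in any order). Let $V'_n\subset V_n$ be the set of $f$ with $f(\mathcal{A}^{n+1,0})\subset A$, $f(\mathcal{A}^{n,1})\subset M$ and $f=0$ on the other $\mathcal{A}^{p,q}$, so $V'_n\cong\mathrm{Hom}(A^{\otimes n+1},A)\oplus\mathrm{Hom}(\mathcal{A}^{n,1},M)$; $V'=\bigoplus_{n\geq 0} V'_n$. Let $\mathfrak{a}_n=\mathrm{Hom}(M^{\otimes n+1},A)\subset V_n$ (extended by zero), $\mathfrak{a}_{-1}=0$, and $P:V\to\mathfrak{a}=\bigoplus_{n\geq 0}\mathfrak{a}_n$ the projection onto the component $M^{\otimes n+1}\to A$. Put $(V'[1]\oplus\mathfrak{a}_c)_i=V'_{i+1}\oplus(\mathfrak{a}_c)_i$ for $i\ge-1$, with $(\mathfrak{a}_c)_i$ the direct sum of $i+2$ copies of $\mathfrak{a}_i$; $f[1]$ denotes $f\in V'$ regarded in $V'[1]$. The $L_\infty$-operations (degree $1$, graded symmetric). For $f\in V'_m$, $g\in V'$: $\widetilde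 l_2(f[1],g[1])=(-1)^m[f,g]_{\mathsf G}[1]$. For $f\in V'_n$ and $\theta^{(s)}=(\theta^{(s)}_1,\ldots,\theta^{(s)}_{i_s+2})\in(\mathfrak{a}_c)_{i_s}$, $s=1,\ldots,n+1$, $\widetilde l_{n+2}(f[1],\theta^{(1)},\ldots,\theta^{(n+1)})\in(\mathfrak{a}_c)_{n+i_1+\cdots+i_{n+1}}$ has $p$-th entry ($1\le p\le n+2+\sum_si_s$) $$\sum_{j_1+\cdots+j_{n+1}=p+n}P[\cdots[[f,\theta^{(1)}_{j_1}]_{\mathsf G},\theta^{(2)}_{j_2}]_{\mathsf G},\ldots,\theta^{(n+1)}_{j_{n+1}}]_{\mathsf G},\qquad1\le j_s\le i_s+2.$$ Up to graded-symmetric permutation of the arguments all other operations vanish. The complex. With $\pi=\mu+l+r\in V'_1$, $\alpha=(\pi[1],(T_1,T_2))$ is a Maurer-Cartan element of this $L_\infty$-algebra, and $\widetilde l_1^{\,\alpha}(x)=\sum_{i\ge0}\frac1{i!}\widetilde l_{i+1}(\alpha,\ldots,\alpha,x)$ ($i$ copies of $\alpha$) is a differential. Set $C^0_{\mathrm{cOA}}=0$, $C^1_{\mathrm{cOA}}=V'_0=\mathrm{Hom}(A,A)\oplus\mathrm{Hom}(M,M)$, and for $n\ge2$ $$C^n_{\mathrm{cOA}}=(V'[1]\oplus\mathfrak{a}_c)_{n-2}=\mathrm{Hom}(A^{\otimes n},A)\oplus\mathrm{Hom}(\mathcal{A}^{n-1,1},M)\oplus\underbrace{\mathrm{Hom}(M^{\otimes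 n-1},A)\oplus\cdots\oplus\mathrm{Hom}(M^{\otimes n-1},A)}_{n},$$ with $\delta_{\mathrm{cOA}}(f,(P_1,\ldots,P_n))=(-1)^{n-2}\,\widetilde l_1^{\,\alpha}(f[1],(P_1,\ldots,P_n))$ on $C^n_{\mathrm{cOA}}$. *)

theory Defs
  imports
    Complex_Main
    "HOL-Library.Function_Algebras"
    "HOL-Library.Product_Plus"
    "HOL-Library.Groups_Big_Fun"
    "HOL-Computational_Algebra.Formal_Power_Series"
begin

section \<open>Compatible O-operator algebras\<close>

text \<open>
  Everything in this section is over a commutative ring, so that it applies both to the ground
  field and to the ring of formal power series over it. Over a field, the locale
  \<^locale>\<open>module\<close> has the same axioms as \<^locale>\<open>vector_space\<close>. Tensor products in the source of a
  linear map are rendered by multilinearity.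
\<close>

definition bilinear_map ::
  "('k::comm_ring_1 \<Rightarrow> 'a::ab_group_add \<Rightarrow> 'a) \<Rightarrow> ('k \<Rightarrow> 'b::ab_group_add \<Rightarrow> 'b) \<Rightarrow>
   ('k \<Rightarrow> 'c::ab_group_add \<Rightarrow> 'c) \<Rightarrow> ('a \<Rightarrow> 'b \<Rightarrow> 'c) \<Rightarrow> bool" where
  "bilinear_map s1 s2 s3 f \<longleftrightarrow>
     (\<forall>x. module_hom s2 s3 (\<lambda>y. f x y)) \<and> (\<forall>y. module_hom s1 s3 (\<lambda>x. f x y))"

locale assoc_algebra = A: module sA
  for sA :: "'k::comm_ring_1 \<Rightarrow> 'a::ab_group_add \<Rightarrow> 'a" +
  fixes mu :: "'a \<Rightarrow> 'a \<Rightarrow> 'a"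
  assumes mu_bilinear: "bilinear_map sA sA sA mu"
    and mu_assoc: "mu (mu a b) c = mu a (mu b c)"

locale assoc_bimodule = assoc_algebra sA mu + M: module sM
  for sA :: "'k::comm_ring_1 \<Rightarrow> 'a::ab_group_add \<Rightarrow> 'a" and mu
    and sM :: "'k \<Rightarrow> 'm::ab_group_add \<Rightarrow> 'm" +
  fixes l :: "'a \<Rightarrow> 'm \<Rightarrow> 'm" and r :: "'m \<Rightarrow> 'a \<Rightarrow> 'm"
  assumes l_bilinear: "bilinear_map sA sM sM l"
    and r_bilinear: "bilinear_map sM sA sM r"
    and l_l: "l (mu a b) u = l a (l b u)"
    and l_r: "r (l a u) b = l a (r u b)"
    and r_r: "r (r u a) b = r u (mu a b)"

record ('a, 'm) oop_data =
  mul :: "'a \<Rightarrow> 'a \<Rightarrow> 'a"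
  lact :: "'a \<Rightarrow> 'm \<Rightarrow> 'm"
  ract :: "'m \<Rightarrow> 'a \<Rightarrow> 'm"
  opr1 :: "'m \<Rightarrow> 'a"
  opr2 :: "'m \<Rightarrow> 'a"

locale compatible_O_operator_algebra =
  assoc_bimodule sA "mul X" sM "lact X" "ract X"
  for sA :: "'k::comm_ring_1 \<Rightarrow> 'a::ab_group_add \<Rightarrow> 'a"
    and sM :: "'k \<Rightarrow> 'm::ab_group_add \<Rightarrow> 'm"
    and X :: "('a, 'm) oop_data" +
  assumes opr1_linear: "module_hom sM sA (opr1 X)"
    and opr2_linear: "module_hom sM sA (opr2 X)"
    and opr1_O_operator:
      "mul X (opr1 X u) (opr1 X v) = opr1 X (lact X (opr1 X u) v + ract X u (opr1 X v))"
    and opr2_O_operator: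
      "mul X (opr2 X u) (opr2 X v) = opr2 X (lact X (opr2 X u) v + ract X u (opr2 X v))"
    and opr_compatible:
      "mul X (opr1 X u) (opr2 X v) + mul X (opr2 X u) (opr1 X v) =
         opr1 X (lact X (opr2 X u) v + ract X u (opr2 X v)) +
         opr2 X (lact X (opr1 X u) v + ract X u (opr1 X v))"

definition oop_morphism ::
  "('k::comm_ring_1 \<Rightarrow> 'a::ab_group_add \<Rightarrow> 'a) \<Rightarrow> ('k \<Rightarrow> 'm::ab_group_add \<Rightarrow> 'm) \<Rightarrow>
   ('k \<Rightarrow> 'b::ab_group_add \<Rightarrow> 'b) \<Rightarrow> ('k \<Rightarrow> 'n::ab_group_add \<Rightarrow> 'n) \<Rightarrow>
   ('a, 'm) oop_data \<Rightarrow> ('b, 'n) oop_data \<Rightarrow> ('a \<Rightarrow> 'b) \<Rightarrow> ('m \<Rightarrow> 'n) \<Rightarrow> bool" where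
  "oop_morphism sA sM sB sN X Y phi psi \<longleftrightarrow>
     module_hom sA sB phi \<and> module_hom sM sN psi \<and>
     (\<forall>a b. phi (mul X a b) = mul Y (phi a) (phi b)) \<and>
     (\<forall>a u. psi (lact X a u) = lact Y (phi a) (psi u)) \<and>
     (\<forall>u a. psi (ract X u a) = ract Y (psi u) (phi a)) \<and>
     (\<forall>u. phi (opr1 X u) = opr1 Y (psi u)) \<and>
     (\<forall>u. phi (opr2 X u) = opr2 Y (psi u))"


section \<open>Formal deformations\<close>

text \<open>
  The module \<open>A[[t]]\<close> over \<open>k[[t]]\<close> is \<^typ>\<open>'a fps\<close> with the scalar multiplication
  \<open>fps_module_scale\<close>. A family of (bi)linear maps \<open>f\<^sub>i\<close> gives the \<open>k[[t]]\<close>-(bi)linear map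
  \<open>\<Sum>\<^sub>i t\<^sup>i f\<^sub>i\<close> between the modules of power series.
\<close>

definition fps_module_scale ::
  "('k::comm_ring_1 \<Rightarrow> 'a::ab_group_add \<Rightarrow> 'a) \<Rightarrow> 'k fps \<Rightarrow> 'a fps \<Rightarrow> 'a fps" where
  "fps_module_scale s c x = Abs_fps (\<lambda>n. \<Sum>i\<le>n. s (fps_nth c i) (fps_nth x (n - i)))"

definition series_linear :: "(nat \<Rightarrow> 'a \<Rightarrow> 'b) \<Rightarrow> 'a fps \<Rightarrow> 'b::comm_monoid_add fps" where
  "series_linear f x = Abs_fps (\<lambda>n. \<Sum>i\<le>n. f i (fps_nth x (n - i)))"

definition series_bilinear ::
  "(nat \<Rightarrow> 'a \<Rightarrow> 'b \<Rightarrow> 'c) \<Rightarrow> 'a fps \<Rightarrow> 'b fps \<Rightarrow> 'c::comm_monoid_add fps" where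
  "series_bilinear f x y =
     Abs_fps (\<lambda>n. \<Sum>i\<le>n. \<Sum>j\<le>n - i. f i (fps_nth x j) (fps_nth y (n - i - j)))"

definition series_oop ::
  "(nat \<Rightarrow> ('a::ab_group_add, 'm::ab_group_add) oop_data) \<Rightarrow> ('a fps, 'm fps) oop_data" where
  "series_oop D =
     \<lparr> mul = series_bilinear (\<lambda>i. mul (D i)),
       lact = series_bilinear (\<lambda>i. lact (D i)),
       ract = series_bilinear (\<lambda>i. ract (D i)),
       opr1 = series_linear (\<lambda>i. opr1 (D i)),
       opr2 = series_linear (\<lambda>i. opr2 (D i)) \<rparr>"

text \<open>
  A deformation is given by its coefficients: \<open>D i\<close> collects the coefficients of \<open>t\<^sup>i\<close> in
  the five power series.
\<close>

definition formal_deformation ::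
  "('k::field_char_0 \<Rightarrow> 'a::ab_group_add \<Rightarrow> 'a) \<Rightarrow> ('k \<Rightarrow> 'm::ab_group_add \<Rightarrow> 'm) \<Rightarrow>
   ('a, 'm) oop_data \<Rightarrow> (nat \<Rightarrow> ('a, 'm) oop_data) \<Rightarrow> bool" where
  "formal_deformation sA sM X D \<longleftrightarrow>
     D 0 = X \<and>
     (\<forall>i. bilinear_map sA sA sA (mul (D i)) \<and>
          bilinear_map sA sM sM (lact (D i)) \<and>
          bilinear_map sM sA sM (ract (D i)) \<and>
          module_hom sM sA (opr1 (D i)) \<and>
          module_hom sM sA (opr2 (D i))) \<and>
     compatible_O_operator_algebra (fps_module_scale sA) (fps_module_scale sM) (series_oop D)"

definition equivalent_deformations ::
  "('k::field_char_0 \<Rightarrow> 'a::ab_group_add \<Rightarrow> 'a) \<Rightarrow> ('k \<Rightarrow> 'm::ab_group_add \<Rightarrow> 'm) \<Rightarrow>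
   (nat \<Rightarrow> ('a, 'm) oop_data) \<Rightarrow> (nat \<Rightarrow> ('a, 'm) oop_data) \<Rightarrow> bool" where
  "equivalent_deformations sA sM D D' \<longleftrightarrow>
     (\<exists>phi psi.
        (\<forall>i. module_hom sA sA (phi i)) \<and> (\<forall>i. module_hom sM sM (psi i)) \<and>
        phi 0 = id \<and> psi 0 = id \<and>
        oop_morphism (fps_module_scale sA) (fps_module_scale sM)
          (fps_module_scale sA) (fps_module_scale sM)
          (series_oop D) (series_oop D') (series_linear phi) (series_linear psi))"


section \<open>The graded spaces and the Gerstenhaber bracket\<close>

text \<open>
  An element of \<open>Hom((A \<oplus> M)\<^sup>\<otimes>\<^sup>n, A \<oplus> M)\<close> is represented by a function on lists that is
  multilinear on lists of length \<open>n\<close> and zero on all other lists, so that equality of such maps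
  is equality of functions. Addition of cochains is the pointwise one of
  \<^theory>\<open>HOL-Library.Function_Algebras\<close> and \<^theory>\<open>HOL-Library.Product_Plus\<close>.
\<close>

type_synonym ('a, 'm) multimap = "('a \<times> 'm) list \<Rightarrow> 'a \<times> 'm"

definition sum_scale ::
  "('k \<Rightarrow> 'a \<Rightarrow> 'a) \<Rightarrow> ('k \<Rightarrow> 'm \<Rightarrow> 'm) \<Rightarrow> 'k \<Rightarrow> 'a \<times> 'm \<Rightarrow> 'a \<times> 'm" where
  "sum_scale sA sM c = map_prod (sA c) (sM c)"

definition V_space ::
  "('k::field_char_0 \<Rightarrow> 'a::ab_group_add \<Rightarrow> 'a) \<Rightarrow> ('k \<Rightarrow> 'm::ab_group_add \<Rightarrow> 'm) \<Rightarrow>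
   nat \<Rightarrow> ('a, 'm) multimap set" where
  "V_space sA sM n = {f.
     (\<forall>vs. length vs \<noteq> n + 1 \<longrightarrow> f vs = 0) \<and>
     (\<forall>vs i. length vs = n + 1 \<and> i < n + 1 \<longrightarrow>
        module_hom (sum_scale sA sM) (sum_scale sA sM) (\<lambda>v. f (vs[i := v])))}"

text \<open>
  The pure tensors in \<open>\<A>\<^sup>p\<^sup>,\<^sup>q\<close>: \<open>S\<close> is the set of positions of the factors in \<open>M\<close>.
\<close>

definition pure_tensors :: "nat \<Rightarrow> nat \<Rightarrow> ('a::zero \<times> 'm::zero) list set" where
  "pure_tensors p q = {vs. length vs = p + q \<and>
     (\<exists>S \<subseteq> {..<p + q}. card S = q \<and>
        (\<forall>i<p + q. if i \<in> S then fst (vs ! i) = 0 else snd (vs ! i) = 0))}"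

definition V'_space ::
  "('k::field_char_0 \<Rightarrow> 'a::ab_group_add \<Rightarrow> 'a) \<Rightarrow> ('k \<Rightarrow> 'm::ab_group_add \<Rightarrow> 'm) \<Rightarrow>
   nat \<Rightarrow> ('a, 'm) multimap set" where
  "V'_space sA sM n = {f \<in> V_space sA sM n.
     (\<forall>vs \<in> pure_tensors (n + 1) 0. snd (f vs) = 0) \<and>
     (\<forall>vs \<in> pure_tensors n 1. fst (f vs) = 0) \<and>
     (\<forall>p q. p + q = n + 1 \<and> 2 \<le> q \<longrightarrow> (\<forall>vs \<in> pure_tensors p q. f vs = 0))}"

definition a_space ::
  "('k::field_char_0 \<Rightarrow> 'a::ab_group_add \<Rightarrow> 'a) \<Rightarrow> ('k \<Rightarrow> 'm::ab_group_add \<Rightarrow> 'm) \<Rightarrow>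
   int \<Rightarrow> ('a, 'm) multimap set" where
  "a_space sA sM i = (if i < 0 then {0} else
     {f \<in> V_space sA sM (nat i).
        (\<forall>vs \<in> pure_tensors 0 (nat i + 1). snd (f vs) = 0) \<and>
        (\<forall>p q. p + q = nat i + 1 \<and> 0 < p \<longrightarrow> (\<forall>vs \<in> pure_tensors p q. f vs = 0))})"

definition proj_a :: "('a::zero, 'm::zero) multimap \<Rightarrow> ('a, 'm) multimap" where
  "proj_a f = (\<lambda>vs. (fst (f (map (\<lambda>v. (0, snd v)) vs)), 0))"

text \<open>\<open>partial_comp n f i g\<close> is \<open>f \<circ>\<^sub>i g\<close> for \<open>g\<close> with \<open>n + 1\<close> arguments; \<open>i\<close> counts from 1.\<close>

definition partial_comp ::
  "nat \<Rightarrow> ('a, 'm) multimap \<Rightarrow> nat \<Rightarrow> ('a, 'm) multimap \<Rightarrow> ('a, 'm) multimap" where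
  "partial_comp n f i g =
     (\<lambda>vs. f (take (i - 1) vs @ [g (take (n + 1) (drop (i - 1) vs))] @ drop (i + n) vs))"

definition gerstenhaber ::
  "('k::field_char_0 \<Rightarrow> 'a::ab_group_add \<Rightarrow> 'a) \<Rightarrow> ('k \<Rightarrow> 'm::ab_group_add \<Rightarrow> 'm) \<Rightarrow>
   nat \<Rightarrow> ('a, 'm) multimap \<Rightarrow> nat \<Rightarrow> ('a, 'm) multimap \<Rightarrow> ('a, 'm) multimap" where
  "gerstenhaber sA sM m f n g = (\<lambda>vs. if length vs = m + n + 1 then
       (\<Sum>i = 1..m + 1. sum_scale sA sM ((-1) ^ ((i - 1) * n)) (partial_comp n f i g vs))
       - sum_scale sA sM ((-1) ^ (m * n))
           (\<Sum>i = 1..n + 1. sum_scale sA sM ((-1) ^ ((i - 1) * m)) (partial_comp m g i f vs))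
     else 0)"

text \<open>
  \<open>[\<cdots>[[f, g\<^sub>1], g\<^sub>2], \<dots>, g\<^sub>k]\<close> for \<open>f\<close> of degree \<open>m\<close>; the list holds the pairs of the degree of
  \<open>g\<^sub>s\<close> and \<open>g\<^sub>s\<close>.
\<close>

fun nested_bracket ::
  "('k::field_char_0 \<Rightarrow> 'a::ab_group_add \<Rightarrow> 'a) \<Rightarrow> ('k \<Rightarrow> 'm::ab_group_add \<Rightarrow> 'm) \<Rightarrow>
   nat \<Rightarrow> ('a, 'm) multimap \<Rightarrow> (nat \<times> ('a, 'm) multimap) list \<Rightarrow> ('a, 'm) multimap" where
  "nested_bracket sA sM m f [] = f"
| "nested_bracket sA sM m f ((n, g) # gs) =
     nested_bracket sA sM (m + n) (gerstenhaber sA sM m f n g) gs"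


section \<open>The L-infinity operations\<close>

text \<open>
  A tuple in \<open>(\<aa>\<^sub>c)\<^sub>i\<close> is a function of its index, which runs from 1 to \<open>i + 2\<close>, and is zero
  elsewhere. A homogeneous element of \<open>V'[1] \<oplus> \<aa>\<^sub>c\<close> is a pair of such components; the
  operations are defined on homogeneous elements, each given together with its degree.
\<close>

type_synonym ('a, 'm) cochain = "('a, 'm) multimap \<times> (nat \<Rightarrow> ('a, 'm) multimap)"

definition ac_space ::
  "('k::field_char_0 \<Rightarrow> 'a::ab_group_add \<Rightarrow> 'a) \<Rightarrow> ('k \<Rightarrow> 'm::ab_group_add \<Rightarrow> 'm) \<Rightarrow>
   int \<Rightarrow> (nat \<Rightarrow> ('a, 'm) multimap) set" where
  "ac_space sA sM i = {th. \<forall>p.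
     if 1 \<le> p \<and> int p \<le> i + 2 then th p \<in> a_space sA sM i else th p = 0}"

definition L_space ::
  "('k::field_char_0 \<Rightarrow> 'a::ab_group_add \<Rightarrow> 'a) \<Rightarrow> ('k \<Rightarrow> 'm::ab_group_add \<Rightarrow> 'm) \<Rightarrow>
   int \<Rightarrow> ('a, 'm) cochain set" where
  "L_space sA sM i = V'_space sA sM (nat (i + 1)) \<times> ac_space sA sM i"

definition cochain_scale ::
  "('k \<Rightarrow> 'a \<Rightarrow> 'a) \<Rightarrow> ('k \<Rightarrow> 'm \<Rightarrow> 'm) \<Rightarrow> 'k \<Rightarrow> ('a, 'm) cochain \<Rightarrow> ('a, 'm) cochain" where
  "cochain_scale sA sM c x =
     (\<lambda>vs. sum_scale sA sM c (fst x vs), \<lambda>p vs. sum_scale sA sM c (snd x p vs))"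

text \<open>
  The tuple \<open>l\<^sub>n\<^sub>+\<^sub>2(f[1], \<theta>\<^sup>1, \<dots>, \<theta>\<^sup>n\<^sup>+\<^sup>1)\<close> for \<open>f \<in> V'\<^sub>n\<close>. The sum is empty for
  \<open>p\<close> outside of \<open>1, \<dots>, n + 2 + \<Sum>\<^sub>s i\<^sub>s\<close>. A \<open>\<theta>\<^sup>s\<close> of degree \<open>-1\<close> is zero, so that the
  value \<open>nat (-1)\<close> given to the bracket as its degree does not matter.
\<close>

definition L_op_theta ::
  "('k::field_char_0 \<Rightarrow> 'a::ab_group_add \<Rightarrow> 'a) \<Rightarrow> ('k \<Rightarrow> 'm::ab_group_add \<Rightarrow> 'm) \<Rightarrow>
   nat \<Rightarrow> ('a, 'm) multimap \<Rightarrow> (int \<times> (nat \<Rightarrow> ('a, 'm) multimap)) list \<Rightarrow>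
   nat \<Rightarrow> ('a, 'm) multimap" where
  "L_op_theta sA sM n f ths = (\<lambda>p.
     \<Sum>js \<in> {js. length js = n + 1 \<and>
               (\<forall>s<n + 1. 1 \<le> js ! s \<and> int (js ! s) \<le> fst (ths ! s) + 2) \<and>
               sum_list js = p + n}.
       proj_a (nested_bracket sA sM n f (map2 (\<lambda>(i, th) j. (nat i, th j)) ths js)))"

text \<open>
  The operation \<open>l\<^sub>k\<close> on a list of \<open>k\<close> homogeneous elements \<open>x\<^sub>s = (f\<^sub>s[1], \<theta>\<^sup>s)\<close>,
  expanded by multilinearity. The first summand is \<open>l\<^sub>2(f\<^sub>1[1], f\<^sub>2[1])\<close>, with \<open>f\<^sub>1 \<in> V'\<^sub>m\<close>
  for \<open>m\<close> the degree of \<open>x\<^sub>1\<close> plus one. The other summands take \<open>f\<^sub>s\<close> from the argument number \<open>s\<close>,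
  which has to be in \<open>V'\<^sub>k\<^sub>-\<^sub>2\<close>, and \<open>\<theta>\<close> from all the others; moving \<open>f\<^sub>s[1]\<close> to the front costs
  the Koszul sign.
\<close>

definition L_op ::
  "('k::field_char_0 \<Rightarrow> 'a::ab_group_add \<Rightarrow> 'a) \<Rightarrow> ('k \<Rightarrow> 'm::ab_group_add \<Rightarrow> 'm) \<Rightarrow>
   (int \<times> ('a, 'm) cochain) list \<Rightarrow> ('a, 'm) cochain" where
  "L_op sA sM xs = (let
       k = length xs;
       deg = (\<lambda>s. fst (xs ! s));
       V_part = (\<lambda>s. fst (snd (xs ! s)))
     in
       (if k = 2 then
          cochain_scale sA sM ((-1) powi (deg 0 + 1))
            (gerstenhaber sA sM (nat (deg 0 + 1)) (V_part 0) (nat (deg 1 + 1)) (V_part 1), 0)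
        else 0) +
       (\<Sum>s<k. if 2 \<le> k \<and> deg s + 1 = int k - 2 then
          cochain_scale sA sM ((-1) powi (deg s * (\<Sum>r<s. deg r)))
            (0, L_op_theta sA sM (k - 2) (V_part s)
                  (map (\<lambda>(d, x). (d, snd x)) (take s xs @ drop (s + 1) xs)))
        else 0))"


section \<open>The cochain complex\<close>

text \<open>
  The element \<open>((\<mu> + l + r)[1], (T\<^sub>1, T\<^sub>2))\<close> of degree 0. It is used for the structure maps, where it
  is the Maurer-Cartan element, and for the first-order terms of a deformation.
\<close>

definition structure_element ::
  "('a::ab_group_add, 'm::ab_group_add) oop_data \<Rightarrow> ('a, 'm) cochain" where
  "structure_element X =
     (\<lambda>vs. case vs of
         [(a, u), (b, v)] \<Rightarrow> (mul X a b, lact X a v + ract X u b)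
       | _ \<Rightarrow> 0,
      \<lambda>p vs. case vs of
         [(a, u)] \<Rightarrow> if p = 1 then (opr1 X u, 0) else if p = 2 then (opr2 X u, 0) else 0
       | _ \<Rightarrow> 0)"

text \<open>
  The twisted operation \<open>l\<^sub>1\<^sup>\<alpha>\<close> on elements of degree \<open>d\<close>. Only finitely many summands are nonzero,
  which is what \<^const>\<open>Sum_any\<close> requires.
\<close>

definition twisted_l1 ::
  "('k::field_char_0 \<Rightarrow> 'a::ab_group_add \<Rightarrow> 'a) \<Rightarrow> ('k \<Rightarrow> 'm::ab_group_add \<Rightarrow> 'm) \<Rightarrow>
   ('a, 'm) oop_data \<Rightarrow> int \<Rightarrow> ('a, 'm) cochain \<Rightarrow> ('a, 'm) cochain" where
  "twisted_l1 sA sM X d x =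
     Sum_any (\<lambda>i. cochain_scale sA sM (1 / fact i)
       (L_op sA sM (replicate i (0, structure_element X) @ [(d, x)])))"

definition C_cOA ::
  "('k::field_char_0 \<Rightarrow> 'a::ab_group_add \<Rightarrow> 'a) \<Rightarrow> ('k \<Rightarrow> 'm::ab_group_add \<Rightarrow> 'm) \<Rightarrow>
   nat \<Rightarrow> ('a, 'm) cochain set" where
  "C_cOA sA sM n = (if n = 0 then {0} else L_space sA sM (int n - 2))"

definition delta_cOA ::
  "('k::field_char_0 \<Rightarrow> 'a::ab_group_add \<Rightarrow> 'a) \<Rightarrow> ('k \<Rightarrow> 'm::ab_group_add \<Rightarrow> 'm) \<Rightarrow>
   ('a, 'm) oop_data \<Rightarrow> nat \<Rightarrow> ('a, 'm) cochain \<Rightarrow> ('a, 'm) cochain" where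
  "delta_cOA sA sM X n x = (if n = 0 then 0 else
     cochain_scale sA sM ((-1) powi (int n - 2)) (twisted_l1 sA sM X (int n - 2) x))"

definition Z_cOA ::
  "('k::field_char_0 \<Rightarrow> 'a::ab_group_add \<Rightarrow> 'a) \<Rightarrow> ('k \<Rightarrow> 'm::ab_group_add \<Rightarrow> 'm) \<Rightarrow>
   ('a, 'm) oop_data \<Rightarrow> nat \<Rightarrow> ('a, 'm) cochain set" where
  "Z_cOA sA sM X n = {x \<in> C_cOA sA sM n. delta_cOA sA sM X n x = 0}"

definition B_cOA ::
  "('k::field_char_0 \<Rightarrow> 'a::ab_group_add \<Rightarrow> 'a) \<Rightarrow> ('k \<Rightarrow> 'm::ab_group_add \<Rightarrow> 'm) \<Rightarrow>
   ('a, 'm) oop_data \<Rightarrow> nat \<Rightarrow> ('a, 'm) cochain set" where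
  "B_cOA sA sM X n =
     (if n = 0 then {0} else delta_cOA sA sM X (n - 1) ` C_cOA sA sM (n - 1))"

definition cohomology_class_cOA ::
  "('k::field_char_0 \<Rightarrow> 'a::ab_group_add \<Rightarrow> 'a) \<Rightarrow> ('k \<Rightarrow> 'm::ab_group_add \<Rightarrow> 'm) \<Rightarrow>
   ('a, 'm) oop_data \<Rightarrow> nat \<Rightarrow> ('a, 'm) cochain \<Rightarrow> ('a, 'm) cochain set" where
  "cohomology_class_cOA sA sM X n z = {z + b | b. b \<in> B_cOA sA sM X n}"

definition infinitesimal ::
  "(nat \<Rightarrow> ('a::ab_group_add, 'm::ab_group_add) oop_data) \<Rightarrow> ('a, 'm) cochain" where
  "infinitesimal D = structure_element (D 1)"

end

theory Submission
  imports Defs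
begin

text \<open>
  The structure maps of a deformation satisfy seven identities over \<open>k[[t]]\<close>: associativity, the
  three bimodule laws, and the identities for \<open>(T\<^sub>1, T\<^sub>1)\<close>, \<open>(T\<^sub>1, T\<^sub>2)\<close> and \<open>(T\<^sub>2, T\<^sub>2)\<close>.
  Evaluated on constant series, their coefficients of \<open>t\<close> are linear in the first-order terms
  \<open>\<mu>\<^sub>1, l\<^sub>1, r\<^sub>1, T\<^sub>1\<^sub>,\<^sub>1, T\<^sub>2\<^sub>,\<^sub>1\<close> (the locale \<open>first_order_deformation\<close>). The cocycle condition
  is exactly this system. Indeed, arguments of degree at most 0 leave only \<open>l\<^sub>2\<close> and \<open>l\<^sub>3\<close> in the
  twisted differential (\<open>twisted_l1_nonpos\<close>), so that with \<open>\<pi> = \<mu> + l + r\<close> and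
  \<open>\<pi>\<^sub>1 = \<mu>\<^sub>1 + l\<^sub>1 + r\<^sub>1\<close> the differential of the infinitesimal has two parts. The first is
  \<open>- [\<pi>, \<pi>\<^sub>1]\<close>; its component in \<open>A\<close> is linearised associativity, and its component in \<open>M\<close> is the
  sum of the three linearised bimodule laws. The second is a triple of maps \<open>M \<otimes> M \<rightarrow> A\<close>. All of
  its terms are double brackets \<open>P[[\<pi>, S], T]\<close>, which are the polarisation of the O-operator
  identity (\<open>O_form\<close>, \<open>projected_double_bracket\<close>); the index \<open>p = 1, 2, 3\<close> selects the linearised
  identity for \<open>(T\<^sub>1, T\<^sub>1)\<close>, \<open>(T\<^sub>1, T\<^sub>2)\<close>, \<open>(T\<^sub>2, T\<^sub>2)\<close>.

  In the same way, the differential of a 1-cochain \<open>f = \<phi>\<^sub>1 + \<psi>\<^sub>1\<close> is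
  \<open>([\<pi>, f], (T\<^sub>p \<circ> \<psi>\<^sub>1 - \<phi>\<^sub>1 \<circ> T\<^sub>p)\<^sub>p)\<close> (\<open>delta_1\<close>). Comparing coefficients of \<open>t\<close> in the
  equations of a morphism \<open>(\<phi>\<^sub>t, \<psi>\<^sub>t)\<close> that starts with the identity shows that the two
  infinitesimals differ by this coboundary (\<open>equivalent_deformations_first_order\<close>).
\<close>

section \<open>Multilinear data\<close>

text \<open>
  The coefficients of a deformation in positive powers of \<open>t\<close> satisfy no identity except
  multilinearity, so the bracket computations are set up for such data.
\<close>

locale multilinear_oop = A: module sA + M: module sM
  for sA :: "'k::field_char_0 \<Rightarrow> 'a::ab_group_add \<Rightarrow> 'a"
    and sM :: "'k \<Rightarrow> 'm::ab_group_add \<Rightarrow> 'm" +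
  fixes Y :: "('a, 'm) oop_data"
  assumes mul_bilinear: "bilinear_map sA sA sA (mul Y)"
    and lact_bilinear: "bilinear_map sA sM sM (lact Y)"
    and ract_bilinear: "bilinear_map sM sA sM (ract Y)"
    and opr1_hom: "module_hom sM sA (opr1 Y)"
    and opr2_hom: "module_hom sM sA (opr2 Y)"

lemma bilinear_map_simps:
  assumes "bilinear_map s1 s2 s3 f"
  shows "f (x + x') y = f x y + f x' y" "f x (y + y') = f x y + f x y'"
    "f 0 y = 0" "f x 0 = 0" "f (s1 c x) y = s3 c (f x y)" "f x (s2 c y) = s3 c (f x y)"
proof -
  have hom: "module_hom s2 s3 (\<lambda>y. f x y)" "module_hom s1 s3 (\<lambda>x. f x y)" for x y
    using assms by (simp_all add: bilinear_map_def)
  show "f (x + x') y = f x y + f x' y" "f x (y + y') = f x y + f x y'"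
    "f 0 y = 0" "f x 0 = 0" "f (s1 c x) y = s3 c (f x y)" "f x (s2 c y) = s3 c (f x y)"
    using module_hom.add[OF hom(2)] module_hom.add[OF hom(1)] module_hom.zero[OF hom(2)]
      module_hom.zero[OF hom(1)] module_hom.scale[OF hom(2)] module_hom.scale[OF hom(1)] by simp_all
qed

lemma module_sum_scale:
  assumes "module sA" "module sM"
  shows "module (sum_scale sA sM)"
proof -
  interpret A: module sA by fact
  interpret M: module sM by fact
  show ?thesis
    by unfold_locales
      (auto simp: sum_scale_def A.scale_right_distrib M.scale_right_distrib
         A.scale_left_distrib M.scale_left_distrib)
qed

lemma sum_scale_simps:
  assumes "module sA" "module sM"
  shows "sum_scale sA sM c 0 = 0" "sum_scale sA sM 1 v = v" "sum_scale sA sM (- 1) v = - v"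
proof -
  interpret module "sum_scale sA sM" using module_sum_scale[OF assms] .
  show "sum_scale sA sM c 0 = 0" "sum_scale sA sM 1 v = v" "sum_scale sA sM (- 1) v = - v"
    by simp_all
qed

lemma cochain_scale_simps:
  assumes "module sA" "module sM"
  shows "cochain_scale sA sM c 0 = 0" "cochain_scale sA sM 1 x = x"
    "cochain_scale sA sM (- 1) x = - x"
  by (auto simp: cochain_scale_def sum_scale_simps[OF assms] prod_eq_iff fun_eq_iff)

context multilinear_oop
begin

lemmas mul_simps = bilinear_map_simps[OF mul_bilinear]
lemmas lact_simps = bilinear_map_simps[OF lact_bilinear]
lemmas ract_simps = bilinear_map_simps[OF ract_bilinear]
lemmas opr1_simps = module_hom.add[OF opr1_hom] module_hom.zero[OF opr1_hom]
lemmas opr2_simps = module_hom.add[OF opr2_hom] module_hom.zero[OF opr2_hom]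

end

section \<open>Low-degree brackets\<close>

lemma gerstenhaber_1_1:
  assumes "module sA" "module sM"
  shows "gerstenhaber sA sM 1 f 1 g = (\<lambda>vs. case vs of
      [x, y, z] \<Rightarrow> f [g [x, y], z] - f [x, g [y, z]] + g [f [x, y], z] - g [x, f [y, z]]
    | _ \<Rightarrow> 0)"
  by (rule ext)
    (auto simp: gerstenhaber_def partial_comp_def sum_scale_simps[OF assms] numeral_eq_Suc
       sum.atLeast_Suc_atMost split: list.splits)

lemma gerstenhaber_1_0:
  assumes "module sA" "module sM"
  shows "gerstenhaber sA sM 1 f 0 g = (\<lambda>vs. case vs of
      [x, y] \<Rightarrow> f [g [x], y] + f [x, g [y]] - g [f [x, y]] | _ \<Rightarrow> 0)"
  by (rule ext)
    (auto simp: gerstenhaber_def partial_comp_def sum_scale_simps[OF assms] numeral_eq_Suc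
       sum.atLeast_Suc_atMost split: list.splits)

lemma gerstenhaber_0_0:
  assumes "module sA" "module sM"
  shows "gerstenhaber sA sM 0 f 0 g = (\<lambda>vs. case vs of
      [x] \<Rightarrow> f [g [x]] - g [f [x]] | _ \<Rightarrow> 0)"
  by (rule ext)
    (auto simp: gerstenhaber_def partial_comp_def sum_scale_simps[OF assms] numeral_eq_Suc
       sum.atLeast_Suc_atMost split: list.splits)

definition operator_cochain :: "('m \<Rightarrow> 'a) \<Rightarrow> ('a::zero, 'm::zero) multimap" where
  "operator_cochain T = (\<lambda>vs. case vs of [(a, u)] \<Rightarrow> (T u, 0) | _ \<Rightarrow> 0)"

text \<open>
  The zero map outside of \<open>p = 1, 2\<close> makes the tuple \<open>(T\<^sub>1, T\<^sub>2)\<close> a family of operators indexed by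
  all \<open>p\<close>, as in the definition of the L-infinity operations.
\<close>
definition opr_at :: "('a::zero, 'm) oop_data \<Rightarrow> nat \<Rightarrow> 'm \<Rightarrow> 'a" where
  "opr_at X p = (if p = 1 then opr1 X else if p = 2 then opr2 X else (\<lambda>_. 0))"

lemma operator_cochain_single: "operator_cochain T [v] = (T (snd v), 0)"
  by (simp add: operator_cochain_def split: prod.split)

lemma operator_cochain_zero: "operator_cochain (\<lambda>_. 0) = 0"
  by (auto simp: operator_cochain_def fun_eq_iff zero_prod_def split: list.splits)

lemma fst_structure_element:
  "fst (structure_element X) vs = (case vs of
     [v, w] \<Rightarrow> (mul X (fst v) (fst w), lact X (fst v) (snd w) + ract X (snd v) (fst w)) | _ \<Rightarrow> 0)"
  by (auto simp: structure_element_def split: list.splits prod.splits)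

lemma snd_structure_element: "snd (structure_element X) = (\<lambda>p. operator_cochain (opr_at X p))"
  by (auto simp: structure_element_def operator_cochain_def opr_at_def fun_eq_iff zero_prod_def
      split: list.splits)

lemma (in multilinear_oop) opr_at_hom: "module_hom sM sA (opr_at Y p)"
  using opr1_hom opr2_hom A.module_axioms M.module_axioms
  by (auto simp: opr_at_def module_hom_iff)

text \<open>
  The symmetric bilinear form in \<open>(S, T)\<close> that polarises the quadratic O-operator identity: its
  value at \<open>(T, T)\<close> is twice the defect of that identity, and its value at \<open>(T\<^sub>1, T\<^sub>2)\<close> is the
  defect of the compatibility condition.
\<close>
definition O_form ::
  "('a::ab_group_add, 'm::ab_group_add) oop_data \<Rightarrow> ('m \<Rightarrow> 'a) \<Rightarrow> ('m \<Rightarrow> 'a) \<Rightarrow> 'm \<Rightarrow> 'm \<Rightarrow> 'a"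
  where
  "O_form Y S T u v = mul Y (S u) (T v) + mul Y (T u) (S v)
     - S (lact Y (T u) v + ract Y u (T v)) - T (lact Y (S u) v + ract Y u (S v))"

text \<open>
  The inner bracket is \<open>\<pi>(S v, w) + \<pi>(v, S w) - S \<pi>(v, w)\<close>. On arguments from \<open>M\<close> the value
  \<open>\<pi>(v, w)\<close> is zero, and \<open>S (T v) = 0\<close> because \<open>T v\<close> has no component in \<open>M\<close>; what survives of the
  outer bracket is \<open>O_form\<close>.
\<close>
lemma (in multilinear_oop) projected_double_bracket:
  assumes S: "module_hom sM sA S" and T: "module_hom sM sA T"
  shows "proj_a (nested_bracket sA sM 1 (fst (structure_element Y))
      [(0, operator_cochain S), (0, operator_cochain T)]) =
    (\<lambda>vs. case vs of [v, w] \<Rightarrow> (O_form Y S T (snd v) (snd w), 0) | _ \<Rightarrow> 0)"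
  using module_hom.add[OF S] module_hom.zero[OF S] module_hom.zero[OF T]
  by (auto simp: fun_eq_iff proj_a_def gerstenhaber_1_0[OF A.module_axioms M.module_axioms, simplified]
     fst_structure_element operator_cochain_single O_form_def mul_simps lact_simps ract_simps
     zero_prod_def split: list.splits)

section \<open>The operations in the twisted differential\<close>

text \<open>
  In \<open>l\<^sub>i\<^sub>+\<^sub>1(\<alpha>, \<dots>, \<alpha>, x)\<close> with \<open>i \<ge> 3\<close> one argument would have to come from \<open>V'\<close> in degree at
  least 1, but \<open>\<alpha>\<close> has degree 0 and \<open>x\<close> has degree at most 0. The operation \<open>l\<^sub>1\<close> is zero.
\<close>
lemma twisted_l1_nonpos:
  assumes "module sA" "module sM" "d \<le> 0"
  shows "twisted_l1 sA sM X d x = L_op sA sM [(0, structure_element X), (d, x)] +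
    cochain_scale sA sM (1 / 2)
      (L_op sA sM [(0, structure_element X), (0, structure_element X), (d, x)])"
proof -
  let ?xs = "\<lambda>i. replicate i (0, structure_element X) @ [(d, x)]"
  have van: "L_op sA sM (?xs i) = 0" if "i \<notin> {1, 2}" for i
  proof -
    have deg: "fst (?xs i ! s) \<le> 0" if "s < Suc i" for s
      using that assms(3) by (auto simp: nth_append)
    have "\<not> (2 \<le> Suc i \<and> fst (?xs i ! s) + 1 = int (Suc i) - 2)" if "s < Suc i" for s
      using deg[OF that] \<open>i \<notin> {1, 2}\<close> by auto
    then show ?thesis using \<open>i \<notin> {1, 2}\<close>
      unfolding L_op_def Let_def by (auto intro!: sum.neutral)
  qed
  have "twisted_l1 sA sM X d x =
      (\<Sum>i\<in>{1, 2}. cochain_scale sA sM (1 / fact i) (L_op sA sM (?xs i)))"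
    unfolding twisted_l1_def
  proof (rule Sum_any.expand_superset)
    show "{i. cochain_scale sA sM (1 / fact i) (L_op sA sM (?xs i)) \<noteq> 0} \<subseteq> {1, 2}"
      using van cochain_scale_simps(1)[OF assms(1,2)]
      by (metis (mono_tags, lifting) mem_Collect_eq subsetI)
  qed simp
  then show ?thesis
    by (simp add: cochain_scale_simps[OF assms(1,2)] numeral_2_eq_2)
qed

lemma L_op_theta_1:
  "L_op_theta sA sM 1 f [(0, th), (0, th')] p =
    (let B = \<lambda>i j. proj_a (nested_bracket sA sM 1 f [(0, th i), (0, th' j)]) in
     if p = 1 then B 1 1 else if p = 2 then B 1 2 + B 2 1 else if p = 3 then B 2 2 else 0)"
proof -
  have *: "{js. length js = 1 + 1 \<and>
      (\<forall>s<1 + 1. 1 \<le> js ! s \<and> int (js ! s) \<le> fst ([(0, th), (0, th')] ! s) + 2) \<and>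
      sum_list js = p + 1} =
    (if p = 1 then {[1,1]} else if p = 2 then {[1,2],[2,1]} else if p = 3 then {[2,2]} else {})"
    (is "?L = ?R")
  proof -
    have "js \<in> ?L \<longleftrightarrow> js \<in> ?R" for js :: "nat list"
      by (cases js; cases "tl js"; cases "tl (tl js)")
         (auto simp: less_Suc_eq all_conj_distrib numeral_eq_Suc)
    then show ?thesis by blast
  qed
  show ?thesis unfolding L_op_theta_def * Let_def by auto
qed

lemma (in multilinear_oop) L_op_theta_operators:
  assumes "\<And>p. module_hom sM sA (S p)" "\<And>p. module_hom sM sA (T p)"
  shows "L_op_theta sA sM 1 (fst (structure_element Y))
      [(0, \<lambda>p. operator_cochain (S p)), (0, \<lambda>p. operator_cochain (T p))] p vs =
    (case vs of [v, w] \<Rightarrow>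
       (let F = \<lambda>i j. O_form Y (S i) (T j) (snd v) (snd w) in
        if p = 1 then F 1 1 else if p = 2 then F 1 2 + F 2 1 else if p = 3 then F 2 2 else 0, 0)
     | _ \<Rightarrow> 0)"
  unfolding L_op_theta_1 projected_double_bracket[OF assms]
  by (auto simp: Let_def zero_prod_def split: list.splits)

lemma L_op_theta_0:
  "L_op_theta sA sM 0 f [(0, th)] p =
    (if p = 1 \<or> p = 2 then proj_a (gerstenhaber sA sM 0 f 0 (th p)) else 0)"
proof -
  have *: "{js. length js = 0 + 1 \<and>
      (\<forall>s<0 + 1. 1 \<le> js ! s \<and> int (js ! s) \<le> fst ([(0, th)] ! s) + 2) \<and>
      sum_list js = p + 0} = (if p = 1 \<or> p = 2 then {[p]} else {})"
    (is "?L = ?R")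
  proof -
    have "js \<in> ?L \<longleftrightarrow> js \<in> ?R" for js :: "nat list"
      by (cases js; cases "tl js") auto
    then show ?thesis by blast
  qed
  show ?thesis unfolding L_op_theta_def * by auto
qed

text \<open>
  A 1-cochain has degree \<open>-1\<close> and the zero tuple as its second component, so this is the term of
  \<open>l\<^sub>3(\<alpha>, \<alpha>, x)\<close> that has to be discarded.
\<close>
lemma (in multilinear_oop) L_op_theta_zero_arg:
  assumes "d \<le> 0"
  shows "L_op_theta sA sM 1 (fst (structure_element Y)) [(0, snd (structure_element Y)), (d, 0)] = 0"
proof -
  have "proj_a (nested_bracket sA sM 1 (fst (structure_element Y))
      (map2 (\<lambda>(i, th) j. (nat i, th j)) [(0, snd (structure_element Y)), (d, 0)] js)) = 0"
    if len: "length js = 1 + 1" for js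
  proof -
    obtain i j where js: "js = [i, j]"
      using len by (auto simp: length_Suc_conv)
    have "module_hom sM sA (\<lambda>_. 0)"
      using opr_at_hom[of 0] by (simp add: opr_at_def)
    from projected_double_bracket[OF opr_at_hom[of i] this] assms show ?thesis
      by (auto simp: js operator_cochain_zero snd_structure_element O_form_def fun_eq_iff
          mul_simps lact_simps ract_simps module_hom.zero[OF opr_at_hom] zero_prod_def
          split: list.splits)
  qed
  then show ?thesis
    unfolding L_op_theta_def by - (rule ext, simp only: zero_fun_apply, rule sum.neutral, blast)
qed

lemma L_op_binary_0:
  assumes "module sA" "module sM"
  shows "L_op sA sM [(0, x), (0, y)] = (- gerstenhaber sA sM 1 (fst x) 1 (fst y), 0)"
  by (simp add: L_op_def numeral_eq_Suc cochain_scale_simps[OF assms])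

lemma L_op_ternary_0:
  assumes "module sA" "module sM"
  shows "L_op sA sM [(0, x), (0, x), (0, y)] =
    (0, L_op_theta sA sM 1 (fst x) [(0, snd x), (0, snd y)] +
        L_op_theta sA sM 1 (fst x) [(0, snd x), (0, snd y)] +
        L_op_theta sA sM 1 (fst y) [(0, snd x), (0, snd x)])"
  by (simp add: L_op_def numeral_eq_Suc lessThan_Suc cochain_scale_simps[OF assms] add_ac)

section \<open>First-order deformations are cocycles\<close>

text \<open>
  The coefficient of \<open>t\<close> in each of the seven identities of a compatible O-operator algebra, for
  structure maps \<open>X + t Y\<close> modulo \<open>t\<^sup>2\<close>. The O-operator identities appear doubled, since
  \<open>O_form\<close> is the polarisation; this is the form in which \<open>O_form_12\<close> is the mixed analogue.
\<close>

locale first_order_deformation =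
  X: multilinear_oop sA sM X + Y: multilinear_oop sA sM Y
  for sA :: "'k::field_char_0 \<Rightarrow> 'a::ab_group_add \<Rightarrow> 'a"
    and sM :: "'k \<Rightarrow> 'm::ab_group_add \<Rightarrow> 'm"
    and X Y +
  assumes mul_mul: "mul Y (mul X a b) c + mul X (mul Y a b) c
      = mul Y a (mul X b c) + mul X a (mul Y b c)"
    and lact_mul: "lact Y (mul X a b) u + lact X (mul Y a b) u
      = lact Y a (lact X b u) + lact X a (lact Y b u)"
    and ract_lact: "ract Y (lact X a u) b + ract X (lact Y a u) b
      = lact Y a (ract X u b) + lact X a (ract Y u b)"
    and ract_ract: "ract Y (ract X u a) b + ract X (ract Y u a) b
      = ract Y u (mul X a b) + ract X u (mul Y a b)"
    and O_form_1: "O_form Y (opr1 X) (opr1 X) u v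
      + O_form X (opr1 X) (opr1 Y) u v + O_form X (opr1 X) (opr1 Y) u v = 0"
    and O_form_2: "O_form Y (opr2 X) (opr2 X) u v
      + O_form X (opr2 X) (opr2 Y) u v + O_form X (opr2 X) (opr2 Y) u v = 0"
    and O_form_12: "O_form Y (opr1 X) (opr2 X) u v
      + O_form X (opr1 X) (opr2 Y) u v + O_form X (opr2 X) (opr1 Y) u v = 0"
begin

lemma bracket_structure_elements:
  "gerstenhaber sA sM 1 (fst (structure_element X)) 1 (fst (structure_element Y)) = 0"
proof -
  \<comment> \<open>Solved for the term with the innermost \<open>Y\<close>, the identities are usable as rewrite rules.\<close>
  have "mul X (mul Y a b) c = mul Y a (mul X b c) + mul X a (mul Y b c) - mul Y (mul X a b) c"
    "lact X (mul Y a b) u = lact Y a (lact X b u) + lact X a (lact Y b u) - lact Y (mul X a b) u"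
    "ract X (lact Y a u) b = lact Y a (ract X u b) + lact X a (ract Y u b) - ract Y (lact X a u) b"
    "ract X (ract Y u a) b = ract Y u (mul X a b) + ract X u (mul Y a b) - ract Y (ract X u a) b"
    for a b c u
    using mul_mul lact_mul ract_lact ract_ract by (simp_all add: eq_diff_eq add.commute)
  then show ?thesis
    by (auto simp: gerstenhaber_1_1[OF X.A.module_axioms X.M.module_axioms, simplified] fun_eq_iff
        fst_structure_element X.mul_simps X.lact_simps X.ract_simps
        Y.mul_simps Y.lact_simps Y.ract_simps algebra_simps prod_eq_iff split: list.splits)
qed

text \<open>
  This is \<open>l\<^sub>3(\<alpha>, \<alpha>, y)\<close> for the element \<open>y\<close> of the first-order terms. Its entries 1 and 3 are the
  doubled identities \<open>O_form_1\<close> and \<open>O_form_2\<close>. Entry 2 is twice \<open>O_form_12\<close>, because the index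
  pairs \<open>(1, 2)\<close> and \<open>(2, 1)\<close> both contribute and \<open>O_form\<close> is symmetric.
\<close>
lemma L_op_theta_structure_elements:
  "L_op_theta sA sM 1 (fst (structure_element X))
      [(0, snd (structure_element X)), (0, snd (structure_element Y))] +
   L_op_theta sA sM 1 (fst (structure_element X))
      [(0, snd (structure_element X)), (0, snd (structure_element Y))] +
   L_op_theta sA sM 1 (fst (structure_element Y))
      [(0, snd (structure_element X)), (0, snd (structure_element X))] = 0"
proof -
  have sym: "O_form Y (opr2 X) (opr1 X) u v = O_form Y (opr1 X) (opr2 X) u v" for u v
    by (simp add: O_form_def algebra_simps)
  have "x + x + (z + z) = 0" if "z + x = 0" for x z :: 'a
    using that by (metis add.assoc add.commute add_0)
  note double = this[of "O_form Y (opr1 X) (opr2 X) u v"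
      "O_form X (opr1 X) (opr2 Y) u v + O_form X (opr2 X) (opr1 Y) u v" for u v]
  show ?thesis
  proof (rule ext, rule ext)
    fix p :: nat and vs :: "('a \<times> 'm) list"
    show "(L_op_theta sA sM 1 (fst (structure_element X))
        [(0, snd (structure_element X)), (0, snd (structure_element Y))] +
      L_op_theta sA sM 1 (fst (structure_element X))
        [(0, snd (structure_element X)), (0, snd (structure_element Y))] +
      L_op_theta sA sM 1 (fst (structure_element Y))
        [(0, snd (structure_element X)), (0, snd (structure_element X))]) p vs = 0 p vs"
      unfolding snd_structure_element plus_fun_apply
        X.L_op_theta_operators[OF X.opr_at_hom Y.opr_at_hom]
        Y.L_op_theta_operators[OF X.opr_at_hom X.opr_at_hom]
      using O_form_1 O_form_2 double O_form_12
      by (auto simp: Let_def opr_at_def sym zero_prod_def add_ac split: list.splits)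
  qed
qed

lemma delta_structure_element: "delta_cOA sA sM X 2 (structure_element Y) = 0"
proof -
  note mods = X.A.module_axioms X.M.module_axioms
  have "twisted_l1 sA sM X 0 (structure_element Y) = 0"
    by (simp only: twisted_l1_nonpos[OF mods order_refl] L_op_binary_0[OF mods]
        L_op_ternary_0[OF mods] bracket_structure_elements L_op_theta_structure_elements
        zero_prod_def[symmetric] cochain_scale_simps[OF mods] minus_zero add_0)
  then show ?thesis
    by (simp add: delta_cOA_def cochain_scale_simps[OF mods])
qed

end

lemma series_nth:
  "fps_nth (series_bilinear f x y) 0 = f 0 (fps_nth x 0) (fps_nth y 0)"
  "fps_nth (series_bilinear f x y) (Suc 0) = f 0 (fps_nth x 0) (fps_nth y 1)
     + f 0 (fps_nth x 1) (fps_nth y 0) + f 1 (fps_nth x 0) (fps_nth y 0)"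
  "fps_nth (series_linear h x) 0 = h 0 (fps_nth x 0)"
  "fps_nth (series_linear h x) (Suc 0) = h 0 (fps_nth x 1) + h 1 (fps_nth x 0)"
  by (simp_all add: series_bilinear_def series_linear_def)

lemma formal_deformation_multilinear:
  assumes "formal_deformation sA sM X D" "module sA" "module sM"
  shows "multilinear_oop sA sM (D i)"
  using assms by (auto simp: formal_deformation_def multilinear_oop_def multilinear_oop_axioms_def)

lemma formal_deformation_first_order:
  fixes sA :: "'k::field_char_0 \<Rightarrow> 'a::ab_group_add \<Rightarrow> 'a"
    and sM :: "'k \<Rightarrow> 'm::ab_group_add \<Rightarrow> 'm"
  assumes D: "formal_deformation sA sM X D" and mods: "module sA" "module sM"
  shows "first_order_deformation sA sM X (D 1)"
proof -
  have D0: "D 0 = X" using D by (simp add: formal_deformation_def)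
  interpret X: multilinear_oop sA sM X
    using formal_deformation_multilinear[OF D mods, of 0] D0 by simp
  interpret Y: multilinear_oop sA sM "D 1"
    using formal_deformation_multilinear[OF D mods] .
  interpret S: compatible_O_operator_algebra
      "fps_module_scale sA" "fps_module_scale sM" "series_oop D"
    using D by (simp add: formal_deformation_def)
  \<comment> \<open>The simplifier turns \<open>D 1\<close> into \<open>D (Suc 0)\<close>, hence the simplified copies of the rules for it.\<close>
  note simps = series_oop_def series_nth D0 X.mul_simps X.lact_simps X.ract_simps
    X.opr1_simps X.opr2_simps
    Y.mul_simps[simplified] Y.lact_simps[simplified] Y.ract_simps[simplified]
    Y.opr1_simps[simplified] Y.opr2_simps[simplified]
  note t_coeff = arg_cong[where f = "\<lambda>x. fps_nth x 1"]
  show ?thesis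
  proof
    fix a b c :: 'a and u v :: 'm
    show "mul (D 1) (mul X a b) c + mul X (mul (D 1) a b) c
        = mul (D 1) a (mul X b c) + mul X a (mul (D 1) b c)"
      using t_coeff[OF S.mu_assoc[of "fps_const a" "fps_const b" "fps_const c"]]
      by (simp add: simps algebra_simps)
    show "lact (D 1) (mul X a b) u + lact X (mul (D 1) a b) u
        = lact (D 1) a (lact X b u) + lact X a (lact (D 1) b u)"
      using t_coeff[OF S.l_l[of "fps_const a" "fps_const b" "fps_const u"]]
      by (simp add: simps algebra_simps)
    show "ract (D 1) (lact X a u) b + ract X (lact (D 1) a u) b
        = lact (D 1) a (ract X u b) + lact X a (ract (D 1) u b)"
      using t_coeff[OF S.l_r[of "fps_const a" "fps_const u" "fps_const b"]]
      by (simp add: simps algebra_simps)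
    show "ract (D 1) (ract X u a) b + ract X (ract (D 1) u a) b
        = ract (D 1) u (mul X a b) + ract X u (mul (D 1) a b)"
      using t_coeff[OF S.r_r[of "fps_const u" "fps_const a" "fps_const b"]]
      by (simp add: simps algebra_simps)
    \<comment> \<open>The O-operator identity for \<open>T\<close> is half of the polarised one: \<open>y\<close> below is half of
      \<open>O_form Y T T\<close> for the first-order structure maps \<open>Y\<close>.\<close>
    have double: "z + x + x = 0" if "z = y + y" "x + y = 0" for x y z :: 'a
      using that by (metis add.assoc add.commute add_0)
    show "O_form (D 1) (opr1 X) (opr1 X) u v
        + O_form X (opr1 X) (opr1 (D 1)) u v + O_form X (opr1 X) (opr1 (D 1)) u v = 0"
      using t_coeff[OF S.opr1_O_operator[of "fps_const u" "fps_const v"]]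
      by (intro double[where y = "mul (D 1) (opr1 X u) (opr1 X v)
            - opr1 X (lact (D 1) (opr1 X u) v + ract (D 1) u (opr1 X v))"])
        (simp_all add: simps O_form_def algebra_simps)
    show "O_form (D 1) (opr2 X) (opr2 X) u v
        + O_form X (opr2 X) (opr2 (D 1)) u v + O_form X (opr2 X) (opr2 (D 1)) u v = 0"
      using t_coeff[OF S.opr2_O_operator[of "fps_const u" "fps_const v"]]
      by (intro double[where y = "mul (D 1) (opr2 X u) (opr2 X v)
            - opr2 X (lact (D 1) (opr2 X u) v + ract (D 1) u (opr2 X v))"])
        (simp_all add: simps O_form_def algebra_simps)
    show "O_form (D 1) (opr1 X) (opr2 X) u v
        + O_form X (opr1 X) (opr2 (D 1)) u v + O_form X (opr2 X) (opr1 (D 1)) u v = 0"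
      using t_coeff[OF S.opr_compatible[of "fps_const u" "fps_const v"]]
      by (simp add: simps O_form_def algebra_simps)
  qed
qed

section \<open>Membership in the cochain spaces\<close>

lemma pure_tensors_A: "vs \<in> pure_tensors p 0 \<Longrightarrow> i < p \<Longrightarrow> snd (vs ! i) = 0"
  by (auto simp: pure_tensors_def finite_subset[of _ "{..<p}"])

lemma pure_tensors_M: "vs \<in> pure_tensors 0 q \<Longrightarrow> i < q \<Longrightarrow> fst (vs ! i) = 0"
  by (auto simp: pure_tensors_def dest: card_subset_eq[OF finite_lessThan])

lemma pure_tensors_1_1:
  assumes "vs \<in> pure_tensors 1 1"
  obtains a u where "vs = [(a, 0), (0, u)]" | a u where "vs = [(0, u), (a, 0)]"
proof -
  from assms obtain S v w where S: "S \<subseteq> {..<2}" "card S = 1"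
      "\<forall>i<2. if i \<in> S then fst (vs ! i) = 0 else snd (vs ! i) = 0" and vs: "vs = [v, w]"
    by (auto simp: pure_tensors_def numeral_eq_Suc length_Suc_conv)
  from S(1,2) have "S = {0} \<or> S = {1}"
    by (auto simp: card_1_singleton_iff numeral_2_eq_2 less_Suc_eq)
  then show ?thesis
    using S(3) that by (cases v; cases w) (auto simp: vs numeral_eq_Suc All_less_Suc)
qed

lemma (in multilinear_oop) structure_element_in_C2: "structure_element Y \<in> C_cOA sA sM 2"
proof -
  note mods = A.module_axioms M.module_axioms
  note msum = module_sum_scale[OF mods]
  have "fst (structure_element Y) \<in> V_space sA sM 1"
    using msum
    by (auto simp: V_space_def module_hom_iff fst_structure_element mul_simps lact_simps ract_simps
        sum_scale_def less_Suc_eq numeral_eq_Suc length_Suc_conv M.scale_right_distrib split: list.splits)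
  moreover have "snd (fst (structure_element Y) vs) = 0" if "vs \<in> pure_tensors 2 0" for vs
    using pure_tensors_A[OF that, of 0] pure_tensors_A[OF that, of 1]
    by (auto simp: fst_structure_element lact_simps ract_simps split: list.splits)
  moreover have "fst (fst (structure_element Y) vs) = 0" if "vs \<in> pure_tensors 1 1" for vs
    using that by (rule pure_tensors_1_1) (simp_all add: fst_structure_element mul_simps)
  moreover have "fst (structure_element Y) vs = 0" if "vs \<in> pure_tensors 0 2" for vs
    using pure_tensors_M[OF that, of 0] pure_tensors_M[OF that, of 1]
    by (auto simp: fst_structure_element mul_simps lact_simps ract_simps zero_prod_def
        split: list.splits)
  moreover have "p = 0 \<and> q = 2" if "p + q = 1 + 1 \<and> 2 \<le> q" for p q :: nat
    using that by linarith
  ultimately have "fst (structure_element Y) \<in> V'_space sA sM 1"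
    unfolding V'_space_def by (simp only: mem_Collect_eq one_add_one) blast
  moreover have "operator_cochain (opr_at Y p) \<in> a_space sA sM 0" for p
  proof -
    note [simp] = module_hom.zero[OF opr_at_hom] module_hom.add[OF opr_at_hom]
      module_hom.scale[OF opr_at_hom]
    have "operator_cochain (opr_at Y p) \<in> V_space sA sM 0"
      using msum
      by (auto simp: V_space_def module_hom_iff operator_cochain_single sum_scale_def
          length_Suc_conv) (auto simp: operator_cochain_def split: list.splits)
    moreover have "operator_cochain (opr_at Y p) vs = 0" if "vs \<in> pure_tensors 1 0" for vs
      using pure_tensors_A[OF that, of 0]
      by (auto simp: operator_cochain_def zero_prod_def split: list.splits)
    moreover have "snd (operator_cochain (opr_at Y p) vs) = 0" for vs
      by (auto simp: operator_cochain_def split: list.splits)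
    moreover have "p = 1 \<and> q = 0" if "p + q = 1 \<and> 0 < p" for p q :: nat
      using that by linarith
    moreover have "a_space sA sM 0 = {f \<in> V_space sA sM 0.
        (\<forall>vs \<in> pure_tensors 0 1. snd (f vs) = 0) \<and>
        (\<forall>p q. p + q = 1 \<and> 0 < p \<longrightarrow> (\<forall>vs \<in> pure_tensors p q. f vs = 0))}"
      by (simp add: a_space_def)
    ultimately show ?thesis by blast
  qed
  ultimately show ?thesis
    by (auto simp: C_cOA_def L_space_def ac_space_def snd_structure_element mem_Times_iff
        opr_at_def operator_cochain_zero)
qed

definition linear_cochain :: "('a \<Rightarrow> 'a) \<Rightarrow> ('m \<Rightarrow> 'm) \<Rightarrow> ('a::zero, 'm::zero) multimap" where
  "linear_cochain \<phi> \<psi> = (\<lambda>vs. case vs of [v] \<Rightarrow> (\<phi> (fst v), \<psi> (snd v)) | _ \<Rightarrow> 0)"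

lemma linear_cochain_in_V':
  assumes phi: "module_hom sA sA \<phi>" and psi: "module_hom sM sM \<psi>"
  shows "linear_cochain \<phi> \<psi> \<in> V'_space sA sM 0"
proof -
  note [simp] = module_hom.zero[OF phi] module_hom.zero[OF psi]
  have "linear_cochain \<phi> \<psi> \<in> V_space sA sM 0"
    using assms module_sum_scale[of sA sM]
    by (auto simp: V_space_def module_hom_iff linear_cochain_def sum_scale_def length_Suc_conv
        split: list.splits)
  moreover have "snd (linear_cochain \<phi> \<psi> vs) = 0" if "vs \<in> pure_tensors 1 0" for vs
    using pure_tensors_A[OF that, of 0] by (auto simp: linear_cochain_def split: list.splits)
  moreover have "fst (linear_cochain \<phi> \<psi> vs) = 0" if "vs \<in> pure_tensors 0 1" for vs
    using pure_tensors_M[OF that, of 0] by (auto simp: linear_cochain_def split: list.splits)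
  ultimately show ?thesis unfolding V'_space_def by auto
qed

lemma V'_space_add:
  assumes "module sA" "module sM" "f \<in> V'_space sA sM n" "g \<in> V'_space sA sM n"
  shows "f + g \<in> V'_space sA sM n"
proof -
  interpret S: module "sum_scale sA sM" using module_sum_scale[OF assms(1,2)] .
  show ?thesis
    using assms(3,4)
    by (auto simp: V'_space_def V_space_def module_hom_iff S.scale_right_distrib add_ac)
qed

lemma V'_space_uminus:
  assumes "module sA" "module sM" "f \<in> V'_space sA sM n"
  shows "- f \<in> V'_space sA sM n"
proof -
  interpret S: module "sum_scale sA sM" using module_sum_scale[OF assms(1,2)] .
  show ?thesis
    using assms(3)
    by (auto simp: V'_space_def V_space_def module_hom_iff S.scale_minus_right)
qed

section \<open>Coboundaries of degree two\<close>

text \<open>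
  The components are \<open>[\<pi>, f]\<close> and \<open>T\<^sub>p \<circ> f - f \<circ> T\<^sub>p\<close>. Written out for functions on lists, they
  are additive in \<open>f\<close> without any linearity of \<open>f\<close>.
\<close>
definition coboundary_1 ::
  "('a::ab_group_add, 'm::ab_group_add) oop_data \<Rightarrow> ('a, 'm) multimap \<Rightarrow> ('a, 'm) cochain" where
  "coboundary_1 X f =
     (\<lambda>vs. case vs of
         [v, w] \<Rightarrow> fst (structure_element X) [f [v], w] + fst (structure_element X) [v, f [w]]
           - f [fst (structure_element X) [v, w]]
       | _ \<Rightarrow> 0,
      \<lambda>p vs. if p \<in> {1, 2} then case vs of
         [v] \<Rightarrow> (opr_at X p (snd (f [(0, snd v)])) - fst (f [(opr_at X p (snd v), 0)]), 0)
       | _ \<Rightarrow> 0 else 0)"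

context multilinear_oop
begin

text \<open>
  Both the factor \<open>(-1)\<^sup>n\<^sup>-\<^sup>2\<close> for \<open>n = 1\<close> and the factor \<open>(-1)\<^sup>m\<close> of \<open>l\<^sub>2\<close> for \<open>m = 1\<close> are
  \<open>-1\<close>. They cancel in the first component, whereas \<open>[f, T\<^sub>p] = f \<circ> T\<^sub>p - T\<^sub>p \<circ> f\<close> is reversed in the
  second.
\<close>
lemma delta_1: "delta_cOA sA sM Y 1 (f, 0) = coboundary_1 Y f"
proof -
  note mods = A.module_axioms M.module_axioms
  have 2: "L_op sA sM [(0, structure_element Y), (- 1, (f, 0))] =
      (- gerstenhaber sA sM 1 (fst (structure_element Y)) 0 f,
       L_op_theta sA sM 0 f [(0, snd (structure_element Y))])"
    by (simp add: L_op_def numeral_eq_Suc lessThan_Suc cochain_scale_simps[OF mods])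
  have 3: "L_op sA sM [(0, structure_element Y), (0, structure_element Y), (- 1, (f, 0))] = 0"
    by (simp add: L_op_def numeral_eq_Suc lessThan_Suc cochain_scale_simps[OF mods]
        L_op_theta_zero_arg[simplified] zero_prod_def)
  have "delta_cOA sA sM Y 1 (f, 0) =
      - L_op sA sM [(0, structure_element Y), (- 1, (f, 0))]"
    by (simp add: delta_cOA_def twisted_l1_nonpos[OF mods] 3 cochain_scale_simps[OF mods])
  also have "\<dots> = (gerstenhaber sA sM 1 (fst (structure_element Y)) 0 f,
      - L_op_theta sA sM 0 f [(0, snd (structure_element Y))])"
    by (simp add: 2)
  also have "\<dots> = coboundary_1 Y f"
    by (auto simp: coboundary_1_def gerstenhaber_1_0[OF mods, simplified] L_op_theta_0 proj_a_def
        gerstenhaber_0_0[OF mods] snd_structure_element operator_cochain_single fun_eq_iff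
        zero_prod_def split: list.splits)
  finally show ?thesis .
qed

lemma coboundary_1_add: "coboundary_1 Y (f + g) = coboundary_1 Y f + coboundary_1 Y g"
  by (auto simp: coboundary_1_def fst_structure_element mul_simps lact_simps ract_simps
      module_hom.add[OF opr_at_hom] fun_eq_iff algebra_simps zero_prod_def prod_eq_iff
      split: list.splits)

lemma coboundary_1_uminus: "coboundary_1 Y (- f) = - coboundary_1 Y f"
proof -
  have "coboundary_1 Y 0 = 0"
    by (auto simp: coboundary_1_def fst_structure_element mul_simps lact_simps ract_simps
        module_hom.zero[OF opr_at_hom] fun_eq_iff zero_prod_def split: list.splits)
  then have "coboundary_1 Y f + coboundary_1 Y (- f) = 0"
    by (simp add: coboundary_1_add[symmetric])
  then show ?thesis by (rule minus_unique[symmetric])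
qed

text \<open>The second component of a 1-cochain lies in copies of \<open>\<aa>\<^sub>-\<^sub>1 = 0\<close>.\<close>
lemma B_cOA_2: "B_cOA sA sM Y 2 = coboundary_1 Y ` V'_space sA sM 0"
proof -
  have "th = 0" if th: "th \<in> ac_space sA sM (- 1)" for th
  proof
    fix p
    have "if 1 \<le> p \<and> int p \<le> - 1 + 2 then th p \<in> a_space sA sM (- 1) else th p = 0"
      using th unfolding ac_space_def mem_Collect_eq by (rule spec)
    then show "th p = 0 p" by (simp add: a_space_def split: if_splits)
  qed
  moreover have "0 \<in> ac_space sA sM (- 1)"
    by (simp add: ac_space_def a_space_def)
  ultimately have "C_cOA sA sM 1 = (\<lambda>f. (f, 0)) ` V'_space sA sM 0"
    by (auto simp: C_cOA_def L_space_def)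
  then show ?thesis
    by (simp add: B_cOA_def image_image delta_1[simplified])
qed

lemma cohomology_class_eqI:
  assumes "z - z' \<in> B_cOA sA sM Y 2"
  shows "cohomology_class_cOA sA sM Y 2 z = cohomology_class_cOA sA sM Y 2 z'"
proof -
  note mods = A.module_axioms M.module_axioms
  have add: "b + c \<in> B_cOA sA sM Y 2" if "b \<in> B_cOA sA sM Y 2" "c \<in> B_cOA sA sM Y 2" for b c
    using that V'_space_add[OF mods] unfolding B_cOA_2
    by (auto simp: coboundary_1_add[symmetric])
  have "z' - z \<in> B_cOA sA sM Y 2"
  proof -
    obtain f where f: "f \<in> V'_space sA sM 0" "z - z' = coboundary_1 Y f"
      using assms unfolding B_cOA_2 by auto
    then have "z' - z = coboundary_1 Y (- f)"
      by (metis coboundary_1_uminus minus_diff_eq)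
    with V'_space_uminus[OF mods f(1)] show ?thesis unfolding B_cOA_2 by blast
  qed
  have "z + b = z' + ((z - z') + b)" "z' + b = z + ((z' - z) + b)" for b
    by simp_all
  then show ?thesis
    using assms \<open>z' - z \<in> _\<close> add unfolding cohomology_class_cOA_def by blast
qed

end

text \<open>
  Since \<open>\<phi>\<^sub>0\<close> and \<open>\<psi>\<^sub>0\<close> are identities, the coefficient of \<open>t\<close> in
  \<open>\<phi>\<^sub>t(\<mu>\<^sub>t(a, b)) = \<mu>'\<^sub>t(\<phi>\<^sub>t a, \<phi>\<^sub>t b)\<close> expresses \<open>\<mu>\<^sub>1 - \<mu>'\<^sub>1\<close> through \<open>\<phi>\<^sub>1\<close> and \<open>\<mu>\<close>, and likewise
  for the actions and the two operators.
\<close>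
lemma equivalent_deformations_first_order:
  assumes D: "formal_deformation sA sM X D" and D': "formal_deformation sA sM X D'"
    and equiv: "equivalent_deformations sA sM D D'" and mods: "module sA" "module sM"
  obtains \<phi> \<psi> where "module_hom sA sA \<phi>" "module_hom sM sM \<psi>"
    "infinitesimal D - infinitesimal D' = coboundary_1 X (linear_cochain \<phi> \<psi>)"
proof -
  have D0: "D 0 = X" "D' 0 = X"
    using D D' by (simp_all add: formal_deformation_def)
  interpret X: multilinear_oop sA sM X
    using formal_deformation_multilinear[OF D mods, of 0] D0 by simp
  obtain phi psi where hom: "\<And>i. module_hom sA sA (phi i)" "\<And>i. module_hom sM sM (psi i)"
    and phi0: "phi 0 = id" and psi0: "psi 0 = id"
    and mor: "oop_morphism (fps_module_scale sA) (fps_module_scale sM)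
          (fps_module_scale sA) (fps_module_scale sM)
          (series_oop D) (series_oop D') (series_linear phi) (series_linear psi)"
    using equiv unfolding equivalent_deformations_def by blast
  from mor have
    mor_mul: "\<And>a b. series_linear phi (mul (series_oop D) a b)
      = mul (series_oop D') (series_linear phi a) (series_linear phi b)" and
    mor_lact: "\<And>a u. series_linear psi (lact (series_oop D) a u)
      = lact (series_oop D') (series_linear phi a) (series_linear psi u)" and
    mor_ract: "\<And>u a. series_linear psi (ract (series_oop D) u a)
      = ract (series_oop D') (series_linear psi u) (series_linear phi a)" and
    mor_opr1: "\<And>u. series_linear phi (opr1 (series_oop D) u)
      = opr1 (series_oop D') (series_linear psi u)" and
    mor_opr2: "\<And>u. series_linear phi (opr2 (series_oop D) u)
      = opr2 (series_oop D') (series_linear psi u)"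
    unfolding oop_morphism_def by blast+
  note simps = series_oop_def series_nth D0 phi0 psi0 X.mul_simps X.lact_simps X.ract_simps
    X.opr1_simps X.opr2_simps
  note t_coeff = arg_cong[where f = "\<lambda>x. fps_nth x 1"]
  have mul: "mul (D 1) a b + phi 1 (mul X a b)
      = mul (D' 1) a b + mul X (phi 1 a) b + mul X a (phi 1 b)" for a b
    using t_coeff[OF mor_mul[of "fps_const a" "fps_const b"]] by (simp add: simps add_ac)
  have lact: "lact (D 1) a u + psi 1 (lact X a u)
      = lact (D' 1) a u + lact X (phi 1 a) u + lact X a (psi 1 u)" for a u
    using t_coeff[OF mor_lact[of "fps_const a" "fps_const u"]] by (simp add: simps add_ac)
  have ract: "ract (D 1) u a + psi 1 (ract X u a)
      = ract (D' 1) u a + ract X (psi 1 u) a + ract X u (phi 1 a)" for a u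
    using t_coeff[OF mor_ract[of "fps_const u" "fps_const a"]] by (simp add: simps add_ac)
  have opr1: "opr1 (D 1) u + phi 1 (opr1 X u) = opr1 (D' 1) u + opr1 X (psi 1 u)" for u
    using t_coeff[OF mor_opr1[of "fps_const u"]] by (simp add: simps add_ac)
  have opr2: "opr2 (D 1) u + phi 1 (opr2 X u) = opr2 (D' 1) u + opr2 X (psi 1 u)" for u
    using t_coeff[OF mor_opr2[of "fps_const u"]] by (simp add: simps add_ac)
  have "mul (D 1) a b = mul (D' 1) a b + mul X (phi 1 a) b + mul X a (phi 1 b) - phi 1 (mul X a b)"
    "lact (D 1) a u = lact (D' 1) a u + lact X (phi 1 a) u + lact X a (psi 1 u) - psi 1 (lact X a u)"
    "ract (D 1) u a = ract (D' 1) u a + ract X (psi 1 u) a + ract X u (phi 1 a) - psi 1 (ract X u a)"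
    "opr1 (D 1) u = opr1 (D' 1) u + opr1 X (psi 1 u) - phi 1 (opr1 X u)"
    "opr2 (D 1) u = opr2 (D' 1) u + opr2 X (psi 1 u) - phi 1 (opr2 X u)" for a b u
    using mul lact ract opr1 opr2 by (simp_all add: eq_diff_eq)
  note first_order = this
  have "infinitesimal D - infinitesimal D' = coboundary_1 X (linear_cochain (phi 1) (psi 1))"
  proof (rule prod_eqI)
    show "fst (infinitesimal D - infinitesimal D') =
        fst (coboundary_1 X (linear_cochain (phi 1) (psi 1)))"
      by (rule ext) (auto simp: infinitesimal_def coboundary_1_def linear_cochain_def
          fst_structure_element first_order first_order[simplified] module_hom.add[OF hom(2)]
          module_hom.add[OF hom(2), simplified] algebra_simps split: list.splits)
    show "snd (infinitesimal D - infinitesimal D') =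
        snd (coboundary_1 X (linear_cochain (phi 1) (psi 1)))"
      by (rule ext, rule ext) (auto simp: infinitesimal_def coboundary_1_def linear_cochain_def
          snd_structure_element operator_cochain_def opr_at_def first_order first_order[simplified]
          zero_prod_def split: list.splits)
  qed
  with hom show ?thesis using that by blast
qed

theorem theorem4p13:
  fixes sA :: "'k::field_char_0 \<Rightarrow> 'a::ab_group_add \<Rightarrow> 'a"
    and sM :: "'k \<Rightarrow> 'm::ab_group_add \<Rightarrow> 'm"
    and X :: "('a, 'm) oop_data"
  assumes "compatible_O_operator_algebra sA sM X"
  shows "(\<forall>D. formal_deformation sA sM X D \<longrightarrow> infinitesimal D \<in> Z_cOA sA sM X 2) \<and>
         (\<forall>D D'. formal_deformation sA sM X D \<and> formal_deformation sA sM X D' \<and>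
            equivalent_deformations sA sM D D' \<longrightarrow>
            cohomology_class_cOA sA sM X 2 (infinitesimal D) =
            cohomology_class_cOA sA sM X 2 (infinitesimal D'))"
proof (intro conjI allI impI)
  interpret X: compatible_O_operator_algebra sA sM X by fact
  note mods = X.A.module_axioms X.M.module_axioms
  show "infinitesimal D \<in> Z_cOA sA sM X 2" if D: "formal_deformation sA sM X D" for D
  proof -
    interpret first_order_deformation sA sM X "D 1"
      using formal_deformation_first_order[OF D mods] .
    show ?thesis
      by (simp only: infinitesimal_def Z_cOA_def mem_Collect_eq Y.structure_element_in_C2
          delta_structure_element)
  qed
  show "cohomology_class_cOA sA sM X 2 (infinitesimal D) =
      cohomology_class_cOA sA sM X 2 (infinitesimal D')"
    if DD': "formal_deformation sA sM X D \<and> formal_deformation sA sM X D' \<and>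
      equivalent_deformations sA sM D D'" for D D'
  proof -
    interpret X: multilinear_oop sA sM X
      using formal_deformation_multilinear[OF conjunct1[OF DD'] mods, of 0] DD'
      by (simp add: formal_deformation_def)
    obtain \<phi> \<psi> where "module_hom sA sA \<phi>" "module_hom sM sM \<psi>"
      "infinitesimal D - infinitesimal D' = coboundary_1 X (linear_cochain \<phi> \<psi>)"
      using DD' mods equivalent_deformations_first_order by metis
    then show ?thesis
      using X.cohomology_class_eqI linear_cochain_in_V' unfolding X.B_cOA_2 by blast
  qed
qed

end
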